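(* Let $(G,\circ,\dotplus,[\![\cdot]\!])$ be an entropy-driven hemi-group with comparable elements (see context), with sign $s$, and assume that $a_s$ is finite. Then for all $\xi,\eta\in G$ and every deterministic system $\varepsilon\in G_s$: 1. $\langle\xi,\eta\rangle\le[\![\xi\circ\eta]\!]$; 2. $\langle\xi,\eta\rangle\le\dfrac{a_s}{a_s-1}\,[\![\xi\dotplus\eta]\!]$, if $a_s\notin[0,1]$; 3. $\langle\xi,\eta\rangle\ge\dfrac{a_s}{\sup\Xi}\,[\![\xi\circ\eta]\!]$, if $a_s<0$ (with $a_s/\infty:=0$); 4. $\langle\xi,\eta\rangle=\rho_{\rm ca}(\xi,\varepsilon)+\rho_{\rm ca}(\eta,\varepsilon)-\rho_{\rm ca}(\xi,\eta)$.
   Context: Entropy: for a topological space $G$, a map $[\![\cdot]\!]:G\to[0,\infty]$ is an entropy if $G_0:=\{\xi\in G:[\![\xi]\!]=0\}$ is measurable, nonempty and not all of $G$, and $[\![\cdot]\!]$ is continuous on $G\setminus G_0$. Entropy-driven hemi-group: let $G^*$ be a topological space, $[\![\cdot]\!]:G^*\to[0,\infty]$ a map, $G\subset G^*$ a measurable subset and $\circ:G\times G^*\to G^*$ a measurable operator. If $[\![\cdot]\!]$ restricted to $G$ is an entropy and $[\![\xi\circ\nu]\!]=[\![\xi]\!]+[\![\nu]\!]$ for all $\xi\in G$, $\nu\in G^*$, then $(G,\circ,[\![\cdot]\!])$ is an entropy-driven hemi-group. Comparable elements: $(G,\circ,\dotplus,[\![\cdot]\!])$ has comparable elements if $(G,\circ,[\![\cdot]\!])$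 is an entropy-driven hemi-group with $[\![\xi]\!]<\infty$ for all $\xi\in G$, and $\dotplus$ is a binary operation on $G$ such that (i) there is a nonempty subset $G_s\subset G_0$ (the deterministic systems) with $[\![\xi\dotplus\eta]\!]=[\![\eta\dotplus\xi]\!]=[\![\xi]\!]$ for all $\xi\in G$, $\eta\in G_s$; and (ii) the function $\xi\mapsto[\![\xi\dotplus\xi]\!]-2[\![\xi]\!]$ on $G$ does not change sign. The sign in (ii) is denoted $s\in\{-1,+1\}$, so $s([\![\xi\dotplus\xi]\!]-2[\![\xi]\!])\ge0$ for all $\xi\in G$ (if the function vanishes identically, $s$ may be chosen freely). For $a\in\mathbb R$: $\rho_a(\xi,\nu)=a[\![\xi\dotplus\nu]\!]+(1-a)[\![\xi\circ\nu]\!]$, $\xi,\nu\in G$, and $\Xi=\{a\in\mathbb R:\rho_a(\xi,\nu)\ge0\ \forall\xi,\nu\in G\}$. Let $M_G=\sup\frac{[\![\xi\dotplus\nu]\!]}{[\![\xi\circ\nu]\!]}\in[1,\infty]$ and $m_G=\inf\frac{[\![\xi\dotplus\nu]\!]}{[\![\xi\circ\nu]\!]}\in[0,1]$ over all $\xi,\nu\in G$ with $[\![\xi\circ\nu]\!]>0$. Let $a_{-1}=1/(1-m_G)$, $a_{+1}=1/(1-M_G)$ (infinite if the denominator is $0$; $a_{+1}=0$ if $M_G=\infty$); $a_s$ is the one selected by the sign $s$. If $a_s$ is finite, the canonical hemi-metric is $\rho_{\rm ca}=\rho_{a_s}$ and the canonical hemi-scalar product is $\langle\xi,\eta\rangl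e=-a_s([\![\xi\dotplus\eta]\!]-[\![\xi\circ\eta]\!])$.
   Formalization: Items 1 and 2 are proved except, when a_s<0, for pairs with [[ξ∘η]]=0 and [[ξ∔η]]>0; M_G ignores such pairs, and both inequalities always fail there. Items 3 and 4 are proved for all pairs. *)

theory Defs
  imports "HOL-Analysis.Analysis"
begin

text \<open>Throughout, \<open>cmp\<close> stands for the operator written as a circle, \<open>dpl\<close> for the dotted plus
  and \<open>ent\<close> for the entropy brackets. The space \<open>G\<^sup>*\<close> is the whole type \<open>'a\<close>.\<close>

definition null_systems :: "'a set \<Rightarrow> ('a \<Rightarrow> ennreal) \<Rightarrow> 'a set" where
  "null_systems G ent = {\<xi> \<in> G. ent \<xi> = 0}"

text \<open>Measurability refers to the Borel sets of the topological space \<open>G\<close>, that is, to the trace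
  on \<open>G\<close> of the Borel sets of the ambient space.\<close>

definition is_entropy :: "'a::topological_space set \<Rightarrow> ('a \<Rightarrow> ennreal) \<Rightarrow> bool" where
  "is_entropy G ent \<longleftrightarrow>
     null_systems G ent \<in> sets (restrict_space borel G) \<and>
     null_systems G ent \<noteq> {} \<and>
     null_systems G ent \<noteq> G \<and>
     continuous_on (G - null_systems G ent) ent"

text \<open>The product \<open>G \<times> G\<^sup>*\<close> carries the Borel sets of the product topology. They contain the
  product of the two Borel \<open>\<sigma>\<close>-algebras, so this is the weaker of the two measurability
  requirements on the operator.\<close>

definition entropy_driven_hemigroup ::
  "'a::topological_space set \<Rightarrow> ('a \<Rightarrow> 'a \<Rightarrow> 'a) \<Rightarrow> ('a \<Rightarrow> ennreal) \<Rightarrow> bool" where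
  "entropy_driven_hemigroup G cmp ent \<longleftrightarrow>
     G \<in> sets borel \<and>
     (\<lambda>(\<xi>, \<nu>). cmp \<xi> \<nu>) \<in> restrict_space borel (G \<times> UNIV) \<rightarrow>\<^sub>M borel \<and>
     is_entropy G ent \<and>
     (\<forall>\<xi>\<in>G. \<forall>\<nu>. ent (cmp \<xi> \<nu>) = ent \<xi> + ent \<nu>)"

definition deterministic_systems ::
  "'a set \<Rightarrow> ('a \<Rightarrow> 'a \<Rightarrow> 'a) \<Rightarrow> ('a \<Rightarrow> ennreal) \<Rightarrow> 'a set \<Rightarrow> bool" where
  "deterministic_systems G dpl ent Gs \<longleftrightarrow>
     Gs \<noteq> {} \<and> Gs \<subseteq> null_systems G ent \<and>
     (\<forall>\<xi>\<in>G. \<forall>\<eta>\<in>Gs. ent (dpl \<xi> \<eta>) = ent \<xi> \<and> ent (dpl \<eta> \<xi>) = ent \<xi>)"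

text \<open>Entropies on \<open>G\<close> are finite for comparable elements, so \<^const>\<open>enn2real\<close>, which would
  send \<open>\<infinity>\<close> to \<open>0\<close>, loses nothing below.\<close>

definition is_sign ::
  "'a set \<Rightarrow> ('a \<Rightarrow> 'a \<Rightarrow> 'a) \<Rightarrow> ('a \<Rightarrow> ennreal) \<Rightarrow> real \<Rightarrow> bool" where
  "is_sign G dpl ent s \<longleftrightarrow>
     s \<in> {-1, 1} \<and>
     (\<forall>\<xi>\<in>G. s * (enn2real (ent (dpl \<xi> \<xi>)) - 2 * enn2real (ent \<xi>)) \<ge> 0)"

definition comparable_elements ::
  "'a::topological_space set \<Rightarrow> ('a \<Rightarrow> 'a \<Rightarrow> 'a) \<Rightarrow> ('a \<Rightarrow> 'a \<Rightarrow> 'a) \<Rightarrow> ('a \<Rightarrow> ennreal) \<Rightarrow> bool" where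
  "comparable_elements G cmp dpl ent \<longleftrightarrow>
     entropy_driven_hemigroup G cmp ent \<and>
     (\<forall>\<xi>\<in>G. ent \<xi> < \<infinity>) \<and>
     (\<forall>\<xi>\<in>G. \<forall>\<nu>\<in>G. dpl \<xi> \<nu> \<in> G) \<and>
     (\<exists>Gs. deterministic_systems G dpl ent Gs) \<and>
     (\<exists>s. is_sign G dpl ent s)"

definition rho ::
  "('a \<Rightarrow> 'a \<Rightarrow> 'a) \<Rightarrow> ('a \<Rightarrow> 'a \<Rightarrow> 'a) \<Rightarrow> ('a \<Rightarrow> ennreal) \<Rightarrow> real \<Rightarrow> 'a \<Rightarrow> 'a \<Rightarrow> real" where
  "rho cmp dpl ent a \<xi> \<nu> =
     a * enn2real (ent (dpl \<xi> \<nu>)) + (1 - a) * enn2real (ent (cmp \<xi> \<nu>))"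

definition Xi ::
  "'a set \<Rightarrow> ('a \<Rightarrow> 'a \<Rightarrow> 'a) \<Rightarrow> ('a \<Rightarrow> 'a \<Rightarrow> 'a) \<Rightarrow> ('a \<Rightarrow> ennreal) \<Rightarrow> real set" where
  "Xi G cmp dpl ent = {a. \<forall>\<xi>\<in>G. \<forall>\<nu>\<in>G. rho cmp dpl ent a \<xi> \<nu> \<ge> 0}"

definition M_G ::
  "'a set \<Rightarrow> ('a \<Rightarrow> 'a \<Rightarrow> 'a) \<Rightarrow> ('a \<Rightarrow> 'a \<Rightarrow> 'a) \<Rightarrow> ('a \<Rightarrow> ennreal) \<Rightarrow> ennreal" where
  "M_G G cmp dpl ent =
     Sup {ent (dpl \<xi> \<nu>) / ent (cmp \<xi> \<nu>) | \<xi> \<nu>. \<xi> \<in> G \<and> \<nu> \<in> G \<and> ent (cmp \<xi> \<nu>) > 0}"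

definition m_G ::
  "'a set \<Rightarrow> ('a \<Rightarrow> 'a \<Rightarrow> 'a) \<Rightarrow> ('a \<Rightarrow> 'a \<Rightarrow> 'a) \<Rightarrow> ('a \<Rightarrow> ennreal) \<Rightarrow> ennreal" where
  "m_G G cmp dpl ent =
     Inf {ent (dpl \<xi> \<nu>) / ent (cmp \<xi> \<nu>) | \<xi> \<nu>. \<xi> \<in> G \<and> \<nu> \<in> G \<and> ent (cmp \<xi> \<nu>) > 0}"

text \<open>The conventions of \<^typ>\<open>ereal\<close> are the intended ones: \<open>1 / 0 = \<infinity>\<close>, and
  \<open>1 / (1 - \<infinity>) = 0\<close>.\<close>

definition a_crit ::
  "'a set \<Rightarrow> ('a \<Rightarrow> 'a \<Rightarrow> 'a) \<Rightarrow> ('a \<Rightarrow> 'a \<Rightarrow> 'a) \<Rightarrow> ('a \<Rightarrow> ennreal) \<Rightarrow> real \<Rightarrow> ereal" where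
  "a_crit G cmp dpl ent s =
     (if s = 1 then 1 / (1 - enn2ereal (M_G G cmp dpl ent))
      else 1 / (1 - enn2ereal (m_G G cmp dpl ent)))"

text \<open>The two canonical functions are meaningful only if \<^const>\<open>a_crit\<close> is finite.\<close>

definition rho_ca ::
  "'a set \<Rightarrow> ('a \<Rightarrow> 'a \<Rightarrow> 'a) \<Rightarrow> ('a \<Rightarrow> 'a \<Rightarrow> 'a) \<Rightarrow> ('a \<Rightarrow> ennreal) \<Rightarrow> real \<Rightarrow> 'a \<Rightarrow> 'a \<Rightarrow> real" where
  "rho_ca G cmp dpl ent s = rho cmp dpl ent (real_of_ereal (a_crit G cmp dpl ent s))"

definition hemi_scalar ::
  "'a set \<Rightarrow> ('a \<Rightarrow> 'a \<Rightarrow> 'a) \<Rightarrow> ('a \<Rightarrow> 'a \<Rightarrow> 'a) \<Rightarrow> ('a \<Rightarrow> ennreal) \<Rightarrow> real \<Rightarrow> 'a \<Rightarrow> 'a \<Rightarrow> real" where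
  "hemi_scalar G cmp dpl ent s \<xi> \<eta> =
     - real_of_ereal (a_crit G cmp dpl ent s) *
       (enn2real (ent (dpl \<xi> \<eta>)) - enn2real (ent (cmp \<xi> \<eta>)))"

text \<open>A pair whose quotient is of the form \<open>c / 0\<close> with \<open>c > 0\<close>. Such a pair is
  left out of the supremum \<^const>\<open>M_G\<close>, so a finite \<^const>\<open>M_G\<close> does not control it. If \<open>a_crit\<close> is
  finite and negative, the two upper bounds for \<open>hemi_scalar\<close> are false at every such pair;
  there, \<open>rho_ca\<close> is negative.\<close>

definition singular_pair ::
  "('a \<Rightarrow> 'a \<Rightarrow> 'a) \<Rightarrow> ('a \<Rightarrow> 'a \<Rightarrow> 'a) \<Rightarrow> ('a \<Rightarrow> ennreal) \<Rightarrow> 'a \<Rightarrow> 'a \<Rightarrow> bool" where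
  "singular_pair cmp dpl ent \<xi> \<nu> \<longleftrightarrow> ent (cmp \<xi> \<nu>) = 0 \<and> ent (dpl \<xi> \<nu>) > 0"

end

theory Submission
  imports Defs
begin

text \<open>Since \<open>ent (cmp \<xi> \<eta>) = ent \<xi> + ent \<eta>\<close> and adding a deterministic system changes no entropy,
  \<open>\<rho>\<^sub>c\<^sub>a(\<xi>, \<epsilon>) = ent \<xi>\<close>, which gives the last claim. The first two claims are both rearrangements of
  \<open>\<rho>\<^sub>c\<^sub>a(\<xi>, \<eta>) \<ge> 0\<close>, and for \<open>a\<^sub>s \<noteq> 0\<close> this holds because the extremal ratio
  defining \<open>a\<^sub>s\<close> equals \<open>1 - 1 / a\<^sub>s\<close>. For the third, each \<open>t \<in> \<Xi>\<close> with \<open>t > 0\<close> bounds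
  \<open>ent (dpl \<xi> \<eta>) - ent (cmp \<xi> \<eta>)\<close> from below by \<open>- ent (cmp \<xi> \<eta>) / t\<close>, and one lets \<open>t\<close> tend to
  \<open>sup \<Xi> \<ge> 1\<close>.\<close>

text \<open>Inverts the formula in \<open>a_crit\<close>. In \<open>ereal\<close>,
  \<open>M = 1\<close> would make the quotient infinite and \<open>M = top\<close> would make it
  \<open>0\<close>, so \<open>M\<close> is a real number different from \<open>1\<close> and can be
  solved for.\<close>

lemma eq_one_minus_inverse_if_one_div_one_minus:
  assumes "1 / (1 - enn2ereal M) = ereal a" and "a \<noteq> 0"
  shows "M = ennreal (1 - 1 / a)" and "0 \<le> 1 - 1 / a"
proof -
  have "M = ennreal (1 - 1 / a) \<and> 0 \<le> 1 - 1 / a"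
  proof (cases M)
    case (real r)
    have "r \<noteq> 1" using assms real by (auto simp: one_ereal_def)
    then have "a = 1 / (1 - r)"
      using assms real by (simp add: one_ereal_def)
    then have "r = 1 - 1 / a" by simp
    then show ?thesis using real by simp
  next
    case top
    then show ?thesis using assms by (simp add: top_ereal_def one_ereal_def zero_ereal_def)
  qed
  then show "M = ennreal (1 - 1 / a)" and "0 \<le> 1 - 1 / a" by auto
qed

text \<open>For \<open>d < 0\<close> every \<open>t\<close> in \<open>X\<close> is at most
  \<open>c / (- d)\<close>, and the supremum inherits this bound without having to lie in
  \<open>X\<close>. The third claim is the case where \<open>X\<close> is \<open>Xi\<close> and
  \<open>c + t * d\<close> is \<open>rho\<close> at parameter \<open>t\<close>.\<close>

lemma divide_Sup_mult_le_if_affine_nonneg: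
  fixes X :: "real set" and c d :: real
  assumes "1 \<in> X" and "\<And>t. t \<in> X \<Longrightarrow> 0 \<le> c + t * d" and "0 \<le> c" and "a < 0"
  shows "ereal a / Sup (ereal ` X) * ereal c \<le> ereal (- a * d)"
proof -
  have ge1: "1 \<le> Sup (ereal ` X)"
    using assms(1) by (auto intro!: Sup_upper simp: one_ereal_def)
  have Sup_le: "Sup (ereal ` X) \<le> ereal (c / (- d))" if "d < 0"
  proof (rule Sup_least)
    fix x assume "x \<in> ereal ` X"
    then obtain t where t: "t \<in> X" "x = ereal t" by auto
    have "t * (- d) \<le> c" using assms(2)[OF t(1)] by simp
    then have "t \<le> c / (- d)" using that by (subst pos_le_divide_eq) auto
    then show "x \<le> ereal (c / (- d))" using t by simp
  qed
  show ?thesis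
  proof (cases "Sup (ereal ` X)")
    case (real S)
    have S: "1 \<le> S" using ge1 real by (simp add: one_ereal_def)
    have "0 \<le> c + S * d"
    proof (cases "0 \<le> d")
      case True
      then show ?thesis using S \<open>0 \<le> c\<close> by simp
    next
      case False
      then show ?thesis using Sup_le real by (simp add: field_simps)
    qed
    then have "- a * (c / S + d) \<ge> 0"
      using \<open>a < 0\<close> S by (intro mult_nonneg_nonneg) (auto simp: field_simps)
    then have "a / S * c \<le> - a * d" by (simp add: algebra_simps)
    then show ?thesis using real S by simp
  next
    case PInf
    \<comment> \<open>A negative slope would bound the supremum by a real number. Once
      \<open>0 \<le> d\<close> holds, the left side vanishes because
      \<open>a / \<infinity> = 0\<close>.\<close>
    have "0 \<le> d"
    proof (rule ccontr)
      assume "\<not> 0 \<le> d"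
      then show False using Sup_le PInf by simp
    qed
    then show ?thesis using PInf \<open>a < 0\<close>
      by (simp add: mult_nonpos_nonneg flip: zero_ereal_def)
  next
    case MInf
    then show ?thesis using ge1 by simp
  qed
qed

lemma ent_cmp:
  assumes "comparable_elements G cmp dpl ent" and "\<xi> \<in> G"
  shows "ent (cmp \<xi> \<nu>) = ent \<xi> + ent \<nu>"
  using assms by (simp add: comparable_elements_def entropy_driven_hemigroup_def)

lemma ent_finite:
  assumes "comparable_elements G cmp dpl ent" and "\<xi> \<in> G" and "\<nu> \<in> G"
  shows "ent \<xi> < top" and "ent (dpl \<xi> \<nu>) < top" and "ent (cmp \<xi> \<nu>) < top"
  using assms by (auto simp: comparable_elements_def entropy_driven_hemigroup_def)

lemma ratio_bounds:
  assumes "\<xi> \<in> G" and "\<nu> \<in> G" and "ent (cmp \<xi> \<nu>) > 0"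
  shows "ent (dpl \<xi> \<nu>) / ent (cmp \<xi> \<nu>) \<le> M_G G cmp dpl ent"
    and "m_G G cmp dpl ent \<le> ent (dpl \<xi> \<nu>) / ent (cmp \<xi> \<nu>)"
  using assms unfolding M_G_def m_G_def by (auto intro!: Sup_upper Inf_lower)

text \<open>A system of positive entropy paired with a deterministic one has ratio exactly \<open>1\<close>.\<close>

lemma
  assumes ce: "comparable_elements G cmp dpl ent"
  shows one_le_M_G: "1 \<le> M_G G cmp dpl ent"
    and m_G_le_one: "m_G G cmp dpl ent \<le> 1"
proof -
  obtain Gs where Gs: "deterministic_systems G dpl ent Gs"
    using ce by (auto simp: comparable_elements_def)
  then obtain \<epsilon> where \<epsilon>: "\<epsilon> \<in> Gs" "\<epsilon> \<in> G" "ent \<epsilon> = 0"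
    by (auto simp: deterministic_systems_def null_systems_def)
  obtain \<xi> where \<xi>: "\<xi> \<in> G" "ent \<xi> \<noteq> 0"
    using ce unfolding comparable_elements_def entropy_driven_hemigroup_def is_entropy_def
      null_systems_def by blast
  have dpl: "ent (dpl \<xi> \<epsilon>) = ent \<xi>" using Gs \<xi> \<epsilon> by (simp add: deterministic_systems_def)
  have cmp: "ent (cmp \<xi> \<epsilon>) = ent \<xi>" using ent_cmp[OF ce \<xi>(1)] \<epsilon> by simp
  have "ent \<xi> / ent \<xi> = 1"
    using \<xi> ent_finite(1)[OF ce \<xi>(1) \<xi>(1)] by (simp add: ennreal_divide_self)
  then show "1 \<le> M_G G cmp dpl ent" and "m_G G cmp dpl ent \<le> 1"
    using ratio_bounds[of \<xi> G \<epsilon> ent cmp dpl] \<xi> \<epsilon> dpl cmp by (auto simp: zero_less_iff_neq_zero)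
qed

text \<open>The extremal ratio lies on a known side of \<open>1\<close>, which fixes the sign of
  \<open>a\<close>. Multiplying the ratio bound by \<open>a * c\<close> then gives the claim for
  \<open>c > 0\<close>. For \<open>c = 0\<close> only \<open>a * p\<close> remains, which is
  negative exactly at a singular pair with \<open>a < 0\<close>.\<close>

lemma rho_a_crit_nonneg:
  assumes ce: "comparable_elements G cmp dpl ent"
    and a: "a_crit G cmp dpl ent s = ereal a"
    and G: "\<xi> \<in> G" "\<eta> \<in> G"
    and ns: "\<not> (a < 0 \<and> singular_pair cmp dpl ent \<xi> \<eta>)"
  shows "0 \<le> rho cmp dpl ent a \<xi> \<eta>"
proof -
  define p where "p = enn2real (ent (dpl \<xi> \<eta>))"
  define c where "c = enn2real (ent (cmp \<xi> \<eta>))"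
  have p: "ent (dpl \<xi> \<eta>) = ennreal p" "0 \<le> p" and c: "ent (cmp \<xi> \<eta>) = ennreal c" "0 \<le> c"
    using ent_finite[OF ce G] by (auto simp: p_def c_def)
  have "0 \<le> a * p + (1 - a) * c"
  proof (cases "s = 1")
    case True
    define M where "M = M_G G cmp dpl ent"
    have eq: "1 / (1 - enn2ereal M) = ereal a" using a True by (simp add: a_crit_def M_def)
    have M: "1 \<le> M" using one_le_M_G[OF ce] by (simp add: M_def)
    show ?thesis
    proof (cases "a = 0")
      case True
      then show ?thesis using c by simp
    next
      case False
      note R = eq_one_minus_inverse_if_one_div_one_minus[OF eq False]
      have "1 \<le> 1 - 1 / a" using M R by (simp add: ennreal_ge_1)
      then have "1 / a \<le> 0" by linarith
      then have "a < 0" using False by (simp add: divide_le_0_1_iff)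
      show ?thesis
      proof (cases "c = 0")
        case True
        then have "p = 0" using ns \<open>a < 0\<close> p c by (simp add: singular_pair_def)
        then show ?thesis using True by simp
      next
        case False
        then have "ennreal p / ennreal c \<le> M"
          using ratio_bounds(1)[of \<xi> G \<eta> ent cmp dpl] G p c by (simp add: M_def)
        then have "p / c \<le> 1 - 1 / a"
          using R p c False by (simp add: divide_ennreal)
        then show ?thesis using \<open>a < 0\<close> c False by (simp add: field_simps)
      qed
    qed
  next
    case False
    define m where "m = m_G G cmp dpl ent"
    have eq: "1 / (1 - enn2ereal m) = ereal a" using a False by (simp add: a_crit_def m_def)
    have m: "m \<le> 1" using m_G_le_one[OF ce] by (simp add: m_def)
    \<comment> \<open>The reciprocal of \<open>1 - m\<close> vanishes only for infinite
      \<open>m\<close>, which \<open>m \<le> 1\<close> excludes.\<close>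
    have "a \<noteq> 0"
      using eq m by (cases m) (auto simp: one_ereal_def zero_ereal_def top_unique split: if_splits)
    note R = eq_one_minus_inverse_if_one_div_one_minus[OF eq this]
    have "1 - 1 / a \<le> 1" using m R by simp
    then have "0 < a" using \<open>a \<noteq> 0\<close> by simp
    show ?thesis
    proof (cases "c = 0")
      case True
      then show ?thesis using \<open>0 < a\<close> p by simp
    next
      case False
      then have "m \<le> ennreal p / ennreal c"
        using ratio_bounds(2)[of \<xi> G \<eta> ent cmp dpl] G p c by (simp add: m_def)
      then have "1 - 1 / a \<le> p / c"
        using R p c False by (simp add: divide_ennreal)
      then show ?thesis using \<open>0 < a\<close> c False by (simp add: field_simps)
    qed
  qed
  then show ?thesis by (simp add: rho_def p_def c_def)
qed

lemma rho_deterministic: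
  assumes ce: "comparable_elements G cmp dpl ent"
    and Gs: "deterministic_systems G dpl ent Gs"
    and "\<xi> \<in> G" and "\<epsilon> \<in> Gs"
  shows "rho cmp dpl ent a \<xi> \<epsilon> = enn2real (ent \<xi>)"
proof -
  have "ent \<epsilon> = 0" "ent (dpl \<xi> \<epsilon>) = ent \<xi>"
    using assms by (auto simp: deterministic_systems_def null_systems_def)
  then show ?thesis
    using ent_cmp[OF ce \<open>\<xi> \<in> G\<close>] by (simp add: rho_def algebra_simps)
qed

theorem proposition3p20:
  fixes G Gs :: "'a::topological_space set"
    and cmp dpl :: "'a \<Rightarrow> 'a \<Rightarrow> 'a"
    and ent :: "'a \<Rightarrow> ennreal"
    and s a :: real
    and \<xi> \<eta> \<epsilon> :: 'a
  assumes "comparable_elements G cmp dpl ent"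
    and "deterministic_systems G dpl ent Gs"
    and "is_sign G dpl ent s"
    and "a_crit G cmp dpl ent s = ereal a"
    and "\<xi> \<in> G" and "\<eta> \<in> G" and "\<epsilon> \<in> Gs"
  shows
    "(\<not> (a < 0 \<and> singular_pair cmp dpl ent \<xi> \<eta>) \<longrightarrow>
        hemi_scalar G cmp dpl ent s \<xi> \<eta> \<le> enn2real (ent (cmp \<xi> \<eta>))) \<and>
     (\<not> (a < 0 \<and> singular_pair cmp dpl ent \<xi> \<eta>) \<longrightarrow> a \<notin> {0..1} \<longrightarrow>
        hemi_scalar G cmp dpl ent s \<xi> \<eta> \<le> a / (a - 1) * enn2real (ent (dpl \<xi> \<eta>))) \<and>
     (a < 0 \<longrightarrow>
        ereal (hemi_scalar G cmp dpl ent s \<xi> \<eta>) \<ge>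
          ereal a / Sup (ereal ` Xi G cmp dpl ent) * enn2ereal (ent (cmp \<xi> \<eta>))) \<and>
     hemi_scalar G cmp dpl ent s \<xi> \<eta> =
       rho_ca G cmp dpl ent s \<xi> \<epsilon> + rho_ca G cmp dpl ent s \<eta> \<epsilon> - rho_ca G cmp dpl ent s \<xi> \<eta>"
proof -
  note ce = assms(1) and G = assms(5,6)
  define p where "p = enn2real (ent (dpl \<xi> \<eta>))"
  define c where "c = enn2real (ent (cmp \<xi> \<eta>))"
  have pc: "0 \<le> p" "0 \<le> c" by (simp_all add: p_def c_def)
  have hs: "hemi_scalar G cmp dpl ent s \<xi> \<eta> = - a * (p - c)"
    using assms(4) by (simp add: hemi_scalar_def p_def c_def)
  \<comment> \<open>As a function of the parameter, \<open>rho\<close> is affine with slope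
    \<open>p - c\<close>; at \<open>t = a\<close> its second term is minus the hemi-scalar
    product.\<close>
  have rho: "rho cmp dpl ent t \<xi> \<eta> = c + t * (p - c)" for t
    by (simp add: rho_def p_def c_def algebra_simps)
  have nonneg: "0 \<le> c + a * (p - c)" if "\<not> (a < 0 \<and> singular_pair cmp dpl ent \<xi> \<eta>)"
    using rho_a_crit_nonneg[OF ce assms(4) G that] rho by simp
  have 1: "- a * (p - c) \<le> c" if "\<not> (a < 0 \<and> singular_pair cmp dpl ent \<xi> \<eta>)"
    using nonneg[OF that] by simp
  have 2: "- a * (p - c) \<le> a / (a - 1) * p"
    if "\<not> (a < 0 \<and> singular_pair cmp dpl ent \<xi> \<eta>)" and "a \<notin> {0..1}"
  proof -
    \<comment> \<open>Outside \<open>[0, 1]\<close> the numbers \<open>a\<close> and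
      \<open>a - 1\<close> have the same sign, so the factor is positive. It is chosen to trade
      \<open>c\<close> for \<open>p\<close>.\<close>
    have "0 \<le> a / (a - 1) * (c + a * (p - c))"
      using nonneg[OF that(1)] that(2) by (intro mult_nonneg_nonneg) (auto simp: zero_le_divide_iff)
    also have "\<dots> = a / (a - 1) * p + a * (p - c)"
    proof -
      have "a - 1 \<noteq> 0" using that(2) by auto
      then show ?thesis by (simp add: divide_simps) (simp add: algebra_simps)
    qed
    finally show ?thesis by simp
  qed
  have cE: "enn2ereal (ent (cmp \<xi> \<eta>)) = ereal c"
    using ent_finite(3)[OF ce G] pc
    by (metis c_def enn2ereal_ennreal ennreal_enn2real)
  have 3: "ereal a / Sup (ereal ` Xi G cmp dpl ent) * ereal c \<le> ereal (- a * (p - c))" if "a < 0"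
  proof (rule divide_Sup_mult_le_if_affine_nonneg)
    \<comment> \<open>At parameter \<open>1\<close> only the entropy of \<open>dpl\<close> survives
      in \<open>rho\<close>.\<close>
    show "1 \<in> Xi G cmp dpl ent" by (simp add: Xi_def rho_def)
    show "0 \<le> c + t * (p - c)" if "t \<in> Xi G cmp dpl ent" for t
      using that G by (auto simp: Xi_def simp flip: rho)
  qed (use pc that in auto)
  have "c = enn2real (ent \<xi>) + enn2real (ent \<eta>)"
    using ent_cmp[OF ce G(1)] ent_finite(1)[OF ce G] ent_finite(1)[OF ce G(2,1)]
    by (simp add: c_def enn2real_plus)
  \<comment> \<open>The two deterministic terms add up to \<open>c\<close>, and subtracting
    \<open>c + a * (p - c)\<close> leaves the left side.\<close>
  then have 4: "- a * (p - c) =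
      rho_ca G cmp dpl ent s \<xi> \<epsilon> + rho_ca G cmp dpl ent s \<eta> \<epsilon> - rho_ca G cmp dpl ent s \<xi> \<eta>"
    using rho_deterministic[OF ce assms(2) _ assms(7)] G rho assms(4) by (simp add: rho_ca_def)
  show ?thesis
    using 1 2 3 4 unfolding hs cE by (simp add: p_def c_def)
qed

end
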